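(* Let $N\ge2$, $\alpha\in(0,1)$, let $\Omega\subset\mathbb{R}^N$ be an open, bounded and smooth domain with $0\in\Omega$, and let $1+\frac{2\alpha}{N}<p<\frac{N}{N-2\alpha}$. Put $\tau_p=-\frac{2\alpha}{p-1}$ and $C_1=C(\tau_p)^{\frac{1}{p-1}}>0$. Let $u$ be the positive solution of $$(-\Delta)^\alpha u+|u|^{p-1}u=0\ \text{ in }\Omega\setminus\{0\},\qquad u=0\ \text{ in }\mathbb{R}^N\setminus\Omega,\qquad \lim_{x\to0}u(x)=+\infty ,$$ which satisfies $\lim_{x\to0}u(x)|x|^{\frac{2\alpha}{p-1}}=C$ for some $C>0$. Then there exists $C_2>0$ such that $$\bigl|u(x)-C_1|x|^{-\frac{2\alpha}{p-1}}\bigr|<C_2,\qquad x\in\Omega\setminus\{0\}.$$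
   Context: For $\alpha\in(0,1)$ the fractional Laplacian is $(-\Delta)^\alpha u(x)=\mathrm{P.V.}\int_{\mathbb{R}^N}\frac{u(x)-u(y)}{|x-y|^{N+2\alpha}}\,dy$. Solutions are classical: continuous on $\mathbb{R}^N\setminus\{0\}$, integrable near $0$, with the principal value existing and the equation holding at every $x\in\Omega\setminus\{0\}$. "Positive" means $u>0$ in $\Omega\setminus\{0\}$. For $\tau\in(-N,0)$, $$C(\tau):=\mathrm{P.V.}\int_{\mathbb{R}^N}\frac{|z-e_1|^\tau-1}{|z|^{N+2\alpha}}\,dz,\qquad e_1=(1,0,\dots,0)\in\mathbb{R}^N .$$ It is known that $C(\tau)>0$ for $\tau\in(-N,-N+2\alpha)$, $C(-N+2\alpha)=0$, and $C(\tau)<0$ for $\tau\in(-N+2\alpha,0)$; under the condition $1+\frac{2\alpha}{N}<p<\frac{N}{N-2\alpha}$, the exponent $\tau_p=-\frac{2\alpha}{p-1}$ satisfies $\tau_p\in(-N,-N+2\alpha)$. *)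

theory Defs
  imports "HOL-Analysis.Analysis"
begin

section \<open>Principal values and the fractional Laplacian\<close>

definition has_pv_integral :: "('a::euclidean_space \<Rightarrow> real) \<Rightarrow> 'a \<Rightarrow> real \<Rightarrow> bool" where
  "has_pv_integral f a I \<longleftrightarrow>
     (\<forall>\<epsilon>>0. set_integrable lborel (- ball a \<epsilon>) f) \<and>
     ((\<lambda>\<epsilon>. set_lebesgue_integral lborel (- ball a \<epsilon>) f) \<longlongrightarrow> I) (at_right 0)"

definition pv_exists :: "('a::euclidean_space \<Rightarrow> real) \<Rightarrow> 'a \<Rightarrow> bool" where
  "pv_exists f a \<longleftrightarrow> (\<exists>I. has_pv_integral f a I)"

definition pv_integral :: "('a::euclidean_space \<Rightarrow> real) \<Rightarrow> 'a \<Rightarrow> real" where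
  "pv_integral f a = (THE I. has_pv_integral f a I)"

text \<open>No normalising constant is put in front of the integral.\<close>

definition frac_kernel :: "real \<Rightarrow> (real^'n \<Rightarrow> real) \<Rightarrow> real^'n \<Rightarrow> real^'n \<Rightarrow> real" where
  "frac_kernel \<alpha> u x y = (u x - u y) / norm (x - y) powr (real CARD('n) + 2 * \<alpha>)"

definition frac_laplacian :: "real \<Rightarrow> (real^'n \<Rightarrow> real) \<Rightarrow> real^'n \<Rightarrow> real" where
  "frac_laplacian \<alpha> u x = pv_integral (frac_kernel \<alpha> u x) x"

text \<open>
  A finite index type has no distinguished element, so the index \<open>i\<close> of the coordinate that
  is called the first one is a parameter: \<open>axis i 1\<close> is the vector \<open>e\<^sub>1\<close>. The value
  does not depend on \<open>i\<close>. The integrand is singular at \<open>e\<^sub>1\<close> too, but integrable there for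
  \<open>\<tau> > - N\<close>; the principal value is taken at the origin only.
\<close>

definition C_coeff :: "'n::finite \<Rightarrow> real \<Rightarrow> real \<Rightarrow> real" where
  "C_coeff i \<alpha> \<tau> =
     pv_integral (\<lambda>z::real^'n. (norm (z - axis i 1) powr \<tau> - 1) /
                                norm z powr (real CARD('n) + 2 * \<alpha>)) 0"

section \<open>Smooth domains\<close>

primrec C_k :: "nat \<Rightarrow> ('a::euclidean_space \<Rightarrow> real) \<Rightarrow> bool" where
  "C_k 0 f \<longleftrightarrow> continuous_on UNIV f"
| "C_k (Suc k) f \<longleftrightarrow>
     f differentiable_on UNIV \<and> (\<forall>v. C_k k (\<lambda>x. frechet_derivative f (at x) v))"

definition C_infinity :: "('a::euclidean_space \<Rightarrow> real) \<Rightarrow> bool" where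
  "C_infinity f \<longleftrightarrow> (\<forall>k. C_k k f)"

text \<open>
  Near each boundary point the set is, in a suitable direction \<open>\<nu>\<close>, the region strictly above
  the graph of a smooth function of the variables orthogonal to \<open>\<nu>\<close>.
\<close>

definition smooth_boundary :: "'a::euclidean_space set \<Rightarrow> bool" where
  "smooth_boundary \<Omega> \<longleftrightarrow>
     (\<forall>x0 \<in> frontier \<Omega>. \<exists>r>0. \<exists>\<nu> \<gamma>. norm \<nu> = 1 \<and> C_infinity \<gamma> \<and>
        \<Omega> \<inter> ball x0 r = {x \<in> ball x0 r. \<gamma> (x - (x \<bullet> \<nu>) *\<^sub>R \<nu>) < x \<bullet> \<nu>})"

definition smooth_bounded_domain :: "'a::euclidean_space set \<Rightarrow> bool" where
  "smooth_bounded_domain \<Omega> \<longleftrightarrow>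
     open \<Omega> \<and> connected \<Omega> \<and> bounded \<Omega> \<and> smooth_boundary \<Omega>"

section \<open>Classical solutions with an isolated singularity at the origin\<close>

text \<open>
  For \<open>0 \<in> \<Omega>\<close> the value \<open>u 0\<close> is irrelevant: it enters no condition below except through integrals, where it
  is negligible.
\<close>

definition singular_solution ::
    "real \<Rightarrow> real \<Rightarrow> (real^'n) set \<Rightarrow> (real^'n \<Rightarrow> real) \<Rightarrow> bool" where
  "singular_solution \<alpha> p \<Omega> u \<longleftrightarrow>
     continuous_on (- {0}) u \<and>
     (\<exists>r>0. set_integrable lborel (ball 0 r) u) \<and>
     (\<forall>x \<in> \<Omega> - {0}. pv_exists (frac_kernel \<alpha> u x) x \<and>
        frac_laplacian \<alpha> u x + \<bar>u x\<bar> powr (p - 1) * u x = 0) \<and>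
     (\<forall>x \<in> - \<Omega>. u x = 0) \<and>
     filterlim u at_top (at 0)"

end

theory Submission
  imports Defs
begin

text \<open>
  The function \<open>|x|\<^sup>\<sigma>\<close> has fractional Laplacian \<open>- C(\<sigma>) |x|\<close> to the power \<open>\<sigma> - 2\<alpha>\<close>. Let
  \<open>\<tau> = \<tau>\<^sub>p\<close>, so that \<open>p\<tau> = \<tau> - 2\<alpha>\<close>, and let \<open>C\<close> be the given limit of \<open>u(x)|x|\<close> to the power \<open>-\<tau>\<close>.
  The difference \<open>d = u - C|x|\<^sup>\<tau>\<close> is \<open>o(|x|\<^sup>\<tau>)\<close>, while its fractional Laplacian is
  \<open>(\<kappa> + o(1)) |x|\<close> to the power \<open>\<tau> - 2\<alpha>\<close> with \<open>\<kappa> = C C(\<tau>) - C\<^sup>p\<close>. If \<open>\<kappa> \<noteq> 0\<close>, comparing \<open>d\<close> or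
  \<open>-d\<close> with a barrier shows that it is at least \<open>\<delta>|x|\<^sup>\<tau> - M\<close> for some \<open>\<delta> > 0\<close>, a
  contradiction. Hence \<open>C = C\<^sub>1\<close>; in particular \<open>C(\<tau>) > 0\<close> need not be known beforehand. Now
  \<open>W = C\<^sub>1|x|\<^sup>\<tau>\<close> solves the equation away from the origin, and comparing \<open>zu\<close> with \<open>W\<close> and \<open>zW\<close> with
  \<open>u + M\<close> for \<open>z < 1\<close>, where \<open>M\<close> bounds \<open>W\<close> outside \<open>\<Omega>\<close>, yields \<open>W - M \<le> u \<le> W\<close>.
\<close>

section \<open>Invariance of Lebesgue measure under similarities\<close>

lemma nn_integral_lborel_translate:
  fixes f :: "'a::euclidean_space \<Rightarrow> ennreal"
  assumes [measurable]: "f \<in> borel_measurable borel"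
  shows "(\<integral>\<^sup>+ x. f (c + x) \<partial>lborel) = (\<integral>\<^sup>+ x. f x \<partial>lborel)"
  using nn_integral_distr[of "(+) c" lborel borel f] by (simp add: lborel_distr_plus)

lemma emeasure_lborel_ball_center_irrelevant:
  fixes c :: "'a::euclidean_space"
  shows "emeasure lborel (ball c r) = emeasure lborel (ball (0::'a) r)"
  by (cases "r \<ge> 0") (simp_all add: emeasure_ball ball_empty)

text \<open>
  A Haar-type uniqueness argument: evaluating
  \<open>\<integral>\<integral> 1\<^sub>B(x) g(x + T y) dy dx\<close>, \<open>B\<close> the unit ball, in both orders of integration gives
  \<open>|B| \<integral> g \<circ> T = |B| \<integral> g\<close>.
\<close>

lemma nn_integral_lborel_orthogonal_transformation:
  fixes T :: "'a::euclidean_space \<Rightarrow> 'a" and g :: "'a \<Rightarrow> ennreal"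
  assumes T: "orthogonal_transformation T" and [measurable]: "g \<in> borel_measurable borel"
  shows "(\<integral>\<^sup>+ y. g (T y) \<partial>lborel) = (\<integral>\<^sup>+ y. g y \<partial>lborel)"
proof -
  let ?B = "ball (0::'a) 1"
  let ?v = "emeasure lborel ?B"
  have [measurable]: "?B \<in> sets borel" by simp
  have lin: "linear T" using T by (rule orthogonal_transformation_linear)
  have Tadd: "T (a + b) = T a + T b" for a b
    using lin by (rule linear_add)
  have Tn: "norm (T x) = norm x" for x
    using T by (simp add: orthogonal_transformation_norm)
  have [measurable]: "T \<in> borel_measurable borel"
    using lin by (intro borel_measurable_continuous_onI linear_continuous_on linear_conv_bounded_linear[THEN iffD1])
  \<comment> \<open>A right inverse of \<open>T\<close>: translating y by \<open>S x\<close> turns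
    \<open>T y\<close> into \<open>x + T y\<close>, so x can be introduced into the inner integral
    without changing its value.\<close>
  obtain S where S: "T (S x) = x" for x
    using orthogonal_transformation_surj[OF T] by (metis surjD)
  have "?v * (\<integral>\<^sup>+ y. g (T y) \<partial>lborel) = (\<integral>\<^sup>+ x. indicator ?B x * (\<integral>\<^sup>+ y. g (T y) \<partial>lborel) \<partial>lborel)"
    by (simp add: mult.commute[of "indicator _ _"] nn_integral_cmult_indicator) (simp add: mult.commute)
  also have "\<dots> = (\<integral>\<^sup>+ x. indicator ?B x * (\<integral>\<^sup>+ y. g (x + T y) \<partial>lborel) \<partial>lborel)"
  proof (rule nn_integral_cong, rule arg_cong2[where f = "(*)"], rule refl)
    fix x
    have "(\<integral>\<^sup>+ y. g (T y) \<partial>lborel) = (\<integral>\<^sup>+ y. g (T (S x + y)) \<partial>lborel)"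
      by (rule nn_integral_lborel_translate[symmetric]) simp
    then show "(\<integral>\<^sup>+ y. g (T y) \<partial>lborel) = (\<integral>\<^sup>+ y. g (x + T y) \<partial>lborel)"
      by (simp add: Tadd S)
  qed
  also have "\<dots> = (\<integral>\<^sup>+ x. (\<integral>\<^sup>+ y. indicator ?B x * g (x + T y) \<partial>lborel) \<partial>lborel)"
    by (simp add: nn_integral_cmult)
  also have "\<dots> = (\<integral>\<^sup>+ y. (\<integral>\<^sup>+ x. indicator ?B x * g (x + T y) \<partial>lborel) \<partial>lborel)"
    by (rule lborel_pair.Fubini'[symmetric]) measurable
  also have "\<dots> = (\<integral>\<^sup>+ y. (\<integral>\<^sup>+ x. indicator ?B (x - T y) * g x \<partial>lborel) \<partial>lborel)"
  proof (rule nn_integral_cong)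
    fix y
    have "(\<integral>\<^sup>+ x. indicator ?B ((T y + x) - T y) * g (T y + x) \<partial>lborel)
        = (\<integral>\<^sup>+ x. indicator ?B (x - T y) * g x \<partial>lborel)"
      by (rule nn_integral_lborel_translate) measurable
    then show "(\<integral>\<^sup>+ x. indicator ?B x * g (x + T y) \<partial>lborel)
        = (\<integral>\<^sup>+ x. indicator ?B (x - T y) * g x \<partial>lborel)"
      by (simp add: add.commute)
  qed
  also have "\<dots> = (\<integral>\<^sup>+ x. (\<integral>\<^sup>+ y. indicator ?B (x - T y) * g x \<partial>lborel) \<partial>lborel)"
    by (rule lborel_pair.Fubini') measurable
  also have "\<dots> = (\<integral>\<^sup>+ x. ?v * g x \<partial>lborel)"
  proof (rule nn_integral_cong)
    fix x
    have "x - T y = T (S x - y)" for y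
      using lin by (simp add: linear_diff S)
    then have "indicator ?B (x - T y) = (indicator (ball (S x) 1) y :: ennreal)" for y
      by (simp add: indicator_def dist_norm Tn)
    then show "(\<integral>\<^sup>+ y. indicator ?B (x - T y) * g x \<partial>lborel) = ?v * g x"
      by (simp add: mult.commute[of "indicator _ _"] nn_integral_cmult_indicator
          emeasure_lborel_ball_center_irrelevant[of "S x"]) (simp add: mult.commute)
  qed
  also have "\<dots> = ?v * (\<integral>\<^sup>+ x. g x \<partial>lborel)"
    by (simp add: nn_integral_cmult)
  finally have eq: "?v * (\<integral>\<^sup>+ y. g (T y) \<partial>lborel) = ?v * (\<integral>\<^sup>+ x. g x \<partial>lborel)" .
  \<comment> \<open>Cancelling in the extended reals requires the volume of the unit ball to be
    neither zero nor infinite.\<close>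
  have "?v \<noteq> 0"
    by (simp add: emeasure_ball unit_ball_vol_pos ennreal_eq_0_iff not_le)
  moreover have "?v \<noteq> \<infinity>"
    using emeasure_lborel_ball_finite[of "0::'a" 1] by simp
  ultimately show ?thesis
    using eq by (simp add: ennreal_mult_cancel_left)
qed

lemma distr_lborel_orthogonal_transformation:
  fixes T :: "'a::euclidean_space \<Rightarrow> 'a"
  assumes T: "orthogonal_transformation T"
  shows "distr lborel borel T = lborel"
proof (rule measure_eqI)
  have [measurable]: "T \<in> borel_measurable borel"
    using T by (intro borel_measurable_continuous_onI linear_continuous_on
        linear_conv_bounded_linear[THEN iffD1] orthogonal_transformation_linear)
  fix A assume "A \<in> sets (distr lborel borel T)"
  then have [measurable]: "A \<in> sets borel" by simp
  have "emeasure (distr lborel borel T) A = (\<integral>\<^sup>+ y. indicator A (T y) \<partial>lborel)"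
    by (subst nn_integral_distr[of T lborel borel "indicator A", symmetric]) simp_all
  also have "\<dots> = emeasure lborel A"
    by (subst nn_integral_lborel_orthogonal_transformation[OF T]) simp_all
  finally show "emeasure (distr lborel borel T) A = emeasure lborel A" .
qed simp

text \<open>The orthogonal part preserves the measure and the dilation contributes the Jacobian. The
  form \<open>x - c *\<^sub>R T z\<close> is chosen so that a kernel depending on x - y becomes one
  in \<open>c *\<^sub>R T z\<close>.\<close>

lemma lborel_similarity:
  fixes T :: "'a::euclidean_space \<Rightarrow> 'a"
  assumes T: "orthogonal_transformation T" and c: "c > 0"
  shows "lborel = density (distr lborel borel (\<lambda>z. x - c *\<^sub>R T z)) (\<lambda>_. ennreal (c ^ DIM('a)))"
proof -
  have [measurable]: "T \<in> borel_measurable borel"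
    using T by (intro borel_measurable_continuous_onI linear_continuous_on
        linear_conv_bounded_linear[THEN iffD1] orthogonal_transformation_linear)
  have "distr lborel borel (\<lambda>z. x - c *\<^sub>R T z)
      = distr (distr lborel borel T) borel (\<lambda>z. x + (- c) *\<^sub>R z)"
    by (subst distr_distr) (simp_all add: o_def)
  also have "\<dots> = distr lborel borel (\<lambda>z. x + (- c) *\<^sub>R z)"
    by (simp only: distr_lborel_orthogonal_transformation[OF T])
  finally show ?thesis
    using lborel_affine[of "- c" x] c by (simp add: ennreal_power)
qed

lemma integral_lborel_similarity:
  fixes T :: "'a::euclidean_space \<Rightarrow> 'a" and g :: "'a \<Rightarrow> real"
  assumes T: "orthogonal_transformation T" and c: "c > 0"
    and [measurable]: "g \<in> borel_measurable borel"
  shows "integrable lborel g \<longleftrightarrow> integrable lborel (\<lambda>z. g (x - c *\<^sub>R T z))"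
    and "integral\<^sup>L lborel g = c ^ DIM('a) * integral\<^sup>L lborel (\<lambda>z. g (x - c *\<^sub>R T z))"
proof -
  have [measurable]: "T \<in> borel_measurable borel"
    using T by (intro borel_measurable_continuous_onI linear_continuous_on
        linear_conv_bounded_linear[THEN iffD1] orthogonal_transformation_linear)
  let ?\<Phi> = "\<lambda>z. x - c *\<^sub>R T z"
  have "integrable lborel g \<longleftrightarrow> integrable (density (distr lborel borel ?\<Phi>) (\<lambda>_. c ^ DIM('a))) g"
    using lborel_similarity[OF T c, of x] by simp
  also have "\<dots> \<longleftrightarrow> integrable lborel (\<lambda>z. g (?\<Phi> z))"
    using c by (subst integrable_density) (simp_all add: integrable_distr_eq)
  finally show "integrable lborel g \<longleftrightarrow> integrable lborel (\<lambda>z. g (?\<Phi> z))" .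
  have "integral\<^sup>L lborel g = integral\<^sup>L (density (distr lborel borel ?\<Phi>) (\<lambda>_. c ^ DIM('a))) g"
    using lborel_similarity[OF T c, of x] by simp
  also have "\<dots> = c ^ DIM('a) * integral\<^sup>L lborel (\<lambda>z. g (?\<Phi> z))"
    using c by (subst integral_density) (simp_all add: integral_distr)
  finally show "integral\<^sup>L lborel g = c ^ DIM('a) * integral\<^sup>L lborel (\<lambda>z. g (?\<Phi> z))" .
qed

section \<open>Principal values\<close>

lemma has_pv_integral_unique:
  assumes "has_pv_integral f a I" "has_pv_integral f a J"
  shows "I = J"
  using assms tendsto_unique[of "at_right (0::real)"] by (auto simp: has_pv_integral_def)

lemma pv_integral_eqI:
  assumes "has_pv_integral f a I"
  shows "pv_integral f a = I"
  unfolding pv_integral_def using assms by (blast intro: has_pv_integral_unique)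

lemma has_pv_integral_pv_integral:
  assumes "pv_exists f a"
  shows "has_pv_integral f a (pv_integral f a)"
  using assms pv_integral_eqI unfolding pv_exists_def by blast

lemma has_pv_integral_add:
  assumes "has_pv_integral f a I" "has_pv_integral g a J"
  shows "has_pv_integral (\<lambda>x. f x + g x) a (I + J)"
proof -
  have f: "set_integrable lborel (- ball a \<epsilon>) f" and g: "set_integrable lborel (- ball a \<epsilon>) g"
    if "\<epsilon> > 0" for \<epsilon>
    using assms that by (auto simp: has_pv_integral_def)
  have "((\<lambda>\<epsilon>. set_lebesgue_integral lborel (- ball a \<epsilon>) f + set_lebesgue_integral lborel (- ball a \<epsilon>) g)
      \<longlongrightarrow> I + J) (at_right 0)"
    using assms by (auto simp: has_pv_integral_def intro!: tendsto_add)
  moreover have "\<forall>\<^sub>F \<epsilon> in at_right 0. set_lebesgue_integral lborel (- ball a \<epsilon>) f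
      + set_lebesgue_integral lborel (- ball a \<epsilon>) g
      = set_lebesgue_integral lborel (- ball a \<epsilon>) (\<lambda>x. f x + g x)"
    using eventually_at_right_less[of "0::real"] by eventually_elim (simp add: f g)
  ultimately show ?thesis
    unfolding has_pv_integral_def using f g
    by (auto elim: Lim_transform_eventually)
qed

lemma has_pv_integral_cmult:
  fixes k :: real
  assumes "has_pv_integral f a I"
  shows "has_pv_integral (\<lambda>x. k * f x) a (k * I)"
  using assms unfolding has_pv_integral_def by (auto intro!: tendsto_mult)

lemma has_pv_integral_zero: "has_pv_integral (\<lambda>x. 0) a 0"
  by (simp add: has_pv_integral_def set_integrable_def set_lebesgue_integral_def)

text \<open>The sign is only asked for almost everywhere because the functions compared later have
  an uncontrolled value at the origin.\<close>

lemma has_pv_integral_nonpos: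
  assumes I: "has_pv_integral f a I" and f: "AE x in lborel. f x \<le> 0"
  shows "I \<le> 0"
proof (rule tendsto_upperbound)
  show "((\<lambda>\<epsilon>. set_lebesgue_integral lborel (- ball a \<epsilon>) f) \<longlongrightarrow> I) (at_right 0)"
    using I by (simp add: has_pv_integral_def)
  have "set_lebesgue_integral lborel (- ball a \<epsilon>) f \<le> 0" for \<epsilon>
    unfolding set_lebesgue_integral_def
  proof -
    have "0 \<le> (\<integral>x. - (indicator (- ball a \<epsilon>) x *\<^sub>R f x) \<partial>lborel)"
      using f by (intro integral_nonneg_AE) (auto elim!: eventually_mono simp: indicator_def)
    then show "(\<integral>x. indicator (- ball a \<epsilon>) x *\<^sub>R f x \<partial>lborel) \<le> 0"
      by simp
  qed
  then show "\<forall>\<^sub>F \<epsilon> in at_right 0. set_lebesgue_integral lborel (- ball a \<epsilon>) f \<le> 0"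
    by simp
qed simp

text \<open>A similarity carries the complement of the ball of radius \<epsilon>/c about 0 to that
  of the ball of radius \<epsilon> about x. The truncated integrals therefore correspond one to one,
  and rescaling the radius does not affect the limit.\<close>

lemma has_pv_integral_similarity:
  fixes T :: "'a::euclidean_space \<Rightarrow> 'a" and f :: "'a \<Rightarrow> real"
  assumes T: "orthogonal_transformation T" and c: "c > 0"
    and [measurable]: "f \<in> borel_measurable borel"
    and J: "has_pv_integral (\<lambda>z. f (x - c *\<^sub>R T z)) 0 J"
  shows "has_pv_integral f x (c ^ DIM('a) * J)"
proof -
  let ?\<Phi> = "\<lambda>z. x - c *\<^sub>R T z"
  have ind: "indicator (- ball x \<epsilon>) (?\<Phi> z) = (indicator (- ball 0 (\<epsilon> / c)) z :: real)" for \<epsilon> z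
    using c T by (simp add: indicator_def dist_norm orthogonal_transformation_norm field_simps)
  have int: "set_integrable lborel (- ball x \<epsilon>) f \<longleftrightarrow>
      set_integrable lborel (- ball 0 (\<epsilon> / c)) (\<lambda>z. f (?\<Phi> z))" for \<epsilon>
    unfolding set_integrable_def
    by (subst integral_lborel_similarity(1)[OF T c, of _ x]) (simp_all add: ind)
  have val: "set_lebesgue_integral lborel (- ball x \<epsilon>) f =
      c ^ DIM('a) * set_lebesgue_integral lborel (- ball 0 (\<epsilon> / c)) (\<lambda>z. f (?\<Phi> z))" for \<epsilon>
    unfolding set_lebesgue_integral_def
    by (subst integral_lborel_similarity(2)[OF T c, of _ x]) (simp_all add: ind)
  have "filterlim (\<lambda>\<epsilon>. \<epsilon> / c) (at_right 0) (at_right 0)"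
    using c by (auto simp: filterlim_at eventually_at_right_less intro!: tendsto_eq_intros
        intro: eventually_mono[OF eventually_at_right_less])
  then have "((\<lambda>\<epsilon>. set_lebesgue_integral lborel (- ball 0 (\<epsilon> / c)) (\<lambda>z. f (?\<Phi> z))) \<longlongrightarrow> J) (at_right 0)"
    using J unfolding has_pv_integral_def by (auto elim: filterlim_compose)
  then have "((\<lambda>\<epsilon>. set_lebesgue_integral lborel (- ball x \<epsilon>) f) \<longlongrightarrow> c ^ DIM('a) * J) (at_right 0)"
    unfolding val by (intro tendsto_mult) auto
  moreover have "\<forall>\<epsilon>>0. set_integrable lborel (- ball x \<epsilon>) f"
    using J c unfolding int has_pv_integral_def by simp
  ultimately show ?thesis
    by (simp add: has_pv_integral_def)
qed

section \<open>The fractional Laplacian of a power of the norm\<close>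

text \<open>On the k-th shell the integrand is at most (R q^k)^s, as s \<le> 0, and the shell lies
  in a ball of volume proportional to (R q^k)^N, with N the dimension. The total is dominated by a
  geometric series of ratio q^(s + N). Taking q = 1/2 treats the origin, q = 2 infinity.\<close>

lemma set_integrable_norm_powr_dyadic:
  fixes A :: "'a::euclidean_space set" and s R q :: real
  assumes s: "s \<le> 0" and R: "R > 0" and q: "q > 0" and conv: "q powr (s + DIM('a)) < 1"
    and A[measurable]: "A \<in> sets borel"
    and cover: "\<And>z. z \<in> A \<Longrightarrow> \<exists>k::nat. R * q ^ k \<le> norm z \<and> norm z < 2 * (R * q ^ k)"
  shows "set_integrable lborel A (\<lambda>z. norm z powr s)"
  unfolding set_integrable_def
proof (rule integrableI_bounded)
  show "(\<lambda>z. indicator A z *\<^sub>R norm z powr s) \<in> borel_measurable lborel"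
    by measurable
  let ?V = "unit_ball_vol (real DIM('a))"
  let ?b = "\<lambda>k::nat. 2 * (R * q ^ k)"
  let ?c = "R powr s * (?V * (2 * R) ^ DIM('a))"
  let ?\<rho> = "q powr (s + DIM('a))"
  have V: "?V > 0" by (simp add: unit_ball_vol_pos)
  have term_eq: "(\<integral>\<^sup>+ z. ennreal ((R * q ^ k) powr s) * indicator (ball (0::'a) (?b k)) z \<partial>lborel)
      = ennreal (?c * ?\<rho> ^ k)" for k
  proof -
    have 1: "(q ^ k) powr s = (q powr s) ^ k"
      using q by (induction k) (simp_all add: powr_mult)
    have 2: "?\<rho> = q powr s * q ^ DIM('a)"
      using q by (simp only: powr_add powr_realpow)
    have "(R * q ^ k) powr s * (?V * ?b k ^ DIM('a)) = ?c * ?\<rho> ^ k"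
    proof -
      have "(R * q ^ k) powr s = R powr s * (q powr s) ^ k"
        using R q by (simp add: powr_mult 1)
      moreover have "?b k ^ DIM('a) = (2 * R) ^ DIM('a) * (q ^ DIM('a)) ^ k"
        by (simp only: power_mult_distrib power_mult[symmetric] mult.commute[of k] mult.assoc)
      moreover have "?\<rho> ^ k = (q powr s) ^ k * (q ^ DIM('a)) ^ k"
        by (simp only: 2 power_mult_distrib)
      ultimately show ?thesis by (simp only: mult_ac)
    qed
    moreover have "(\<integral>\<^sup>+ z. ennreal ((R * q ^ k) powr s) * indicator (ball (0::'a) (?b k)) z \<partial>lborel)
      = ennreal ((R * q ^ k) powr s) * emeasure lborel (ball (0::'a) (?b k))"
      by (rule nn_integral_cmult_indicator) simp
    moreover have "emeasure lborel (ball (0::'a) (?b k)) = ennreal (?V * ?b k ^ DIM('a))"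
      using R q by (intro emeasure_ball) simp
    moreover have "ennreal ((R * q ^ k) powr s) * ennreal (?V * ?b k ^ DIM('a)) =
        ennreal ((R * q ^ k) powr s * (?V * ?b k ^ DIM('a)))"
      using R q V by (intro ennreal_mult[symmetric]) auto
    ultimately show ?thesis
      by metis
  qed
  have le_suminf: "h k \<le> (\<Sum>j. h j)" for h :: "nat \<Rightarrow> ennreal" and k
  proof -
    have "sum h {k} \<le> (\<Sum>j. h j)" by (rule sum_le_suminf) simp_all
    then show ?thesis by simp
  qed
  have "(\<integral>\<^sup>+ z. ennreal (norm (indicator A z *\<^sub>R norm z powr s)) \<partial>lborel) \<le>
      (\<integral>\<^sup>+ z. (\<Sum>k. ennreal ((R * q ^ k) powr s) * indicator (ball (0::'a) (?b k)) z) \<partial>lborel)"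
  proof (rule nn_integral_mono)
    fix z :: 'a
    show "ennreal (norm (indicator A z *\<^sub>R norm z powr s)) \<le>
      (\<Sum>k. ennreal ((R * q ^ k) powr s) * indicator (ball (0::'a) (?b k)) z)"
    proof (cases "z \<in> A")
      case True
      then obtain k where k: "R * q ^ k \<le> norm z" "norm z < ?b k" using cover by blast
      have "norm z powr s \<le> (R * q ^ k) powr s"
        using k R q s by (intro powr_mono2') auto
      then have "ennreal (norm (indicator A z *\<^sub>R norm z powr s))
          \<le> ennreal ((R * q ^ k) powr s) * indicator (ball (0::'a) (?b k)) z"
        using True k by (simp add: indicator_def ennreal_leI)
      also have "\<dots> \<le> (\<Sum>k. ennreal ((R * q ^ k) powr s) * indicator (ball (0::'a) (?b k)) z)"
        by (rule le_suminf)
      finally show ?thesis .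
    qed simp
  qed
  also have "\<dots> = (\<Sum>k. \<integral>\<^sup>+ z. ennreal ((R * q ^ k) powr s) * indicator (ball (0::'a) (?b k)) z \<partial>lborel)"
    by (intro nn_integral_suminf borel_measurable_times_ennreal borel_measurable_const
        borel_measurable_indicator) simp
  also have "\<dots> = (\<Sum>k. ennreal (?c * ?\<rho> ^ k))"
    by (simp only: term_eq)
  also have "\<dots> = ennreal (\<Sum>k. ?c * ?\<rho> ^ k)"
  proof (rule suminf_ennreal2)
    show "summable (\<lambda>k. ?c * ?\<rho> ^ k)"
      using conv q by (intro summable_mult summable_geometric) simp
    show "0 \<le> ?c * ?\<rho> ^ k" for k
      using R V by (intro mult_nonneg_nonneg zero_le_power) auto
  qed
  also have "\<dots> < \<infinity>" by simp
  finally show "(\<integral>\<^sup>+ z. ennreal (norm (indicator A z *\<^sub>R norm z powr s)) \<partial>lborel) < \<infinity>" .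
qed

lemma set_integrable_norm_powr_ball:
  assumes s: "s \<le> 0" "- real DIM('a::euclidean_space) < s" and R: "R > 0"
  shows "set_integrable lborel (ball (0::'a) R) (\<lambda>z. norm z powr s)"
proof -
  have "set_integrable lborel (ball (0::'a) R - {0}) (\<lambda>z. norm z powr s)"
  proof (rule set_integrable_norm_powr_dyadic[OF s(1) R, of "1/2"])
    show "(1/2) powr (s + real DIM('a)) < 1"
      using s powr_less_mono'[of "1/2" 0 "s + real DIM('a)"] by simp
    fix z :: 'a assume z: "z \<in> ball 0 R - {0}"
    define P where "P = (\<lambda>k::nat. R * (1/2) ^ k \<le> norm z)"
    have "\<exists>k. (1/2::real) ^ k < norm z / R"
      using z R by (intro real_arch_pow_inv) auto
    then have ex: "\<exists>k. P k"
      using R unfolding P_def by (auto simp: field_simps intro: less_imp_le)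
    \<comment> \<open>The least k is positive, and the failure of \<open>P\<close> at its
      predecessor is the upper bound: one halving fewer doubles the radius.\<close>
    define k where "k = (LEAST k. P k)"
    have k: "P k" unfolding k_def using ex by (rule LeastI_ex)
    have "\<not> P 0" using z by (simp add: P_def)
    then obtain j where j: "k = Suc j" using k by (cases k) auto
    then have "\<not> P j" unfolding k_def by (metis lessI not_less_Least)
    then show "\<exists>k. R * (1/2) ^ k \<le> norm z \<and> norm z < 2 * (R * (1/2) ^ k)"
      using k j by (intro exI[of _ k]) (auto simp: P_def)
  qed auto
  \<comment> \<open>The origin, which lies in no shell, can be put back because
    \<open>0 powr s = 0\<close>.\<close>
  moreover have "(\<lambda>z. indicator (ball 0 R - {0}) z *\<^sub>R norm z powr s) =
      (\<lambda>z::'a. indicator (ball 0 R) z *\<^sub>R norm z powr s)"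
    by (auto simp: indicator_def)
  ultimately show ?thesis by (simp add: set_integrable_def)
qed

lemma set_integrable_norm_powr_compl_ball:
  assumes s: "s < - real DIM('a::euclidean_space)" and R: "R > 0"
  shows "set_integrable lborel (- ball (0::'a) R) (\<lambda>z. norm z powr s)"
proof (rule set_integrable_norm_powr_dyadic[OF _ R, of _ 2])
  show "s \<le> 0" using s by simp
  show "2 powr (s + real DIM('a)) < 1"
    using s powr_less_mono[of "s + real DIM('a)" 0 2] by simp
  fix z :: 'a assume z: "z \<in> - ball 0 R"
  define P where "P = (\<lambda>k::nat. norm z < R * 2 ^ k)"
  have "\<exists>k. norm z / R < 2 ^ k"
    by (intro real_arch_pow) auto
  then have ex: "\<exists>k. P k"
    using R unfolding P_def by (auto simp: field_simps)
  define k where "k = (LEAST k. P k)"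
  have k: "P k" unfolding k_def using ex by (rule LeastI_ex)
  have "\<not> P 0" using z by (simp add: P_def)
  then obtain j where j: "k = Suc j" using k by (cases k) auto
  then have "\<not> P j" unfolding k_def by (metis lessI not_less_Least)
  \<comment> \<open>The shell containing z has index j, one below the least k with |z| < R
    2^k.\<close>
  then show "\<exists>k. R * 2 ^ k \<le> norm z \<and> norm z < 2 * (R * 2 ^ k)"
    using k j by (intro exI[of _ j]) (auto simp: P_def)
qed auto

text \<open>Taylor's formula of order two at 1. The bound t \<ge> 1/4 keeps the intermediate point
  away from 0, where the second derivative blows up; the factor 1/2 is given away.\<close>

lemma powr_quadratic_remainder:
  fixes a t :: real
  assumes a: "a \<le> 0" and t: "1/4 \<le> t"
  shows "\<bar>t powr a - 1 - a * (t - 1)\<bar> \<le> a * (a - 1) * (1/4) powr (a - 2) * (t - 1)\<^sup>2"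
proof (cases "t = 1")
  case False
  define D where "D = (\<lambda>(m::nat) x::real. if m = 0 then x powr a else if m = 1 then a * x powr (a - 1)
      else a * (a - 1) * x powr (a - 2))"
  have "\<exists>\<xi>. (if t < 1 then t < \<xi> \<and> \<xi> < 1 else 1 < \<xi> \<and> \<xi> < t) \<and>
      t powr a = (\<Sum>m<2. (D m 1 / fact m) * (t - 1) ^ m) + (D 2 \<xi> / fact 2) * (t - 1) ^ 2"
  proof (rule Taylor[where a = "1/4" and b = "max t 1"])
    show "\<forall>m x. m < 2 \<and> 1/4 \<le> x \<and> x \<le> max t 1 \<longrightarrow> (D m has_real_derivative D (Suc m) x) (at x)"
    proof (intro allI impI)
      fix m :: nat and x :: real assume mx: "m < 2 \<and> 1/4 \<le> x \<and> x \<le> max t 1"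
      then consider "m = 0" | "m = 1" by linarith
      then show "(D m has_real_derivative D (Suc m) x) (at x)"
        using mx by cases (auto simp: D_def intro!: derivative_eq_intros)
    qed
  qed (use t False in \<open>auto simp: D_def\<close>)
  then obtain \<xi> where \<xi>0: "if t < 1 then t < \<xi> \<and> \<xi> < 1 else 1 < \<xi> \<and> \<xi> < t" and
    eq: "t powr a = (\<Sum>m<2. (D m 1 / fact m) * (t - 1) ^ m) + (D 2 \<xi> / fact 2) * (t - 1) ^ 2"
    by blast
  have \<xi>: "1/4 \<le> \<xi>" using \<xi>0 t by (auto split: if_splits)
  define B where "B = a * (a - 1) * \<xi> powr (a - 2) / 2"
  have aa: "0 \<le> a * (a - 1)" using a by (simp add: mult_nonpos_nonpos)
  have B: "0 \<le> B" unfolding B_def using aa by simp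
  have "\<xi> powr (a - 2) \<le> (1/4) powr (a - 2)"
    using a \<xi> by (intro powr_mono2') auto
  then have "a * (a - 1) * \<xi> powr (a - 2) \<le> a * (a - 1) * (1/4) powr (a - 2)"
    using aa by (rule mult_left_mono)
  then have B_le: "B \<le> a * (a - 1) * (1/4) powr (a - 2)"
    using B unfolding B_def by linarith
  have "t powr a - 1 - a * (t - 1) = B * (t - 1)\<^sup>2"
    unfolding eq by (simp add: D_def B_def numeral_2_eq_2)
  moreover have "\<bar>B * (t - 1)\<^sup>2\<bar> = B * (t - 1)\<^sup>2"
    using B by simp
  ultimately show ?thesis
    using mult_right_mono[OF B_le, of "(t - 1)\<^sup>2"] by simp
qed simp

text \<open>For t = |z - e|^2 = 1 + |z|^2 - 2 z.e the first-order term of t^(\<sigma>/2) contains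
  z.e, which is odd in z and cancels when z and -z are added. What remains is quadratic in |z|. The
  restriction |z| \<le> 1/2 ensures t \<ge> 1/4.\<close>

lemma norm_powr_second_difference:
  fixes \<sigma> :: real
  assumes \<sigma>: "\<sigma> \<le> 0"
  obtains Q where "Q \<ge> 0" and "\<And>e z :: 'a::euclidean_space. norm e = 1 \<Longrightarrow> norm z \<le> 1/2 \<Longrightarrow>
      \<bar>norm (z - e) powr \<sigma> + norm (- z - e) powr \<sigma> - 2\<bar> \<le> Q * (norm z)\<^sup>2"
proof -
  define a where "a = \<sigma> / 2"
  define K where "K = a * (a - 1) * (1/4) powr (a - 2)"
  have a: "a \<le> 0" using \<sigma> by (simp add: a_def)
  have K: "K \<ge> 0" unfolding K_def using a by (intro mult_nonneg_nonneg mult_nonpos_nonpos) auto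
  have *: "\<bar>norm (z - e) powr \<sigma> - 1 - a * ((norm z)\<^sup>2 - 2 * (z \<bullet> e))\<bar> \<le> K * (9 * (norm z)\<^sup>2)"
    if e: "norm e = 1" and z: "norm z \<le> 1/2" for e z :: 'a
  proof -
    define t where "t = (norm (z - e))\<^sup>2"
    have t1: "t - 1 = (norm z)\<^sup>2 - 2 * (z \<bullet> e)"
      using e unfolding t_def power2_norm_eq_inner
      by (simp add: inner_diff inner_commute norm_eq_1)
    have ge: "1/2 \<le> norm (z - e)"
      using norm_triangle_ineq2[of e z] e z by (simp add: norm_minus_commute)
    then have "t \<ge> (1/2)\<^sup>2" unfolding t_def by (intro power_mono) auto
    then have t4: "1/4 \<le> t" by (simp add: power2_eq_square)
    have "norm (z - e) powr \<sigma> = t powr a"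
    proof -
      have "t = norm (z - e) powr 2" using ge by (simp add: t_def)
      then show ?thesis unfolding a_def by (simp only: powr_powr) simp
    qed
    \<comment> \<open>One |z| comes from |z|^2 \<le> |z|, two from 2 |z.e|; squaring yields the
      factor 9.\<close>
    moreover have "\<bar>t - 1\<bar> \<le> 3 * norm z"
    proof -
      have "\<bar>z \<bullet> e\<bar> \<le> norm z" using Cauchy_Schwarz_ineq2[of z e] e by simp
      moreover have "(norm z)\<^sup>2 \<le> norm z" using z
        by (simp add: power2_eq_square mult_left_le)
      ultimately show ?thesis unfolding t1 using zero_le_power2[of "norm z"] by linarith
    qed
    then have "\<bar>t - 1\<bar>\<^sup>2 \<le> (3 * norm z)\<^sup>2" by (intro power_mono) auto
    then have "(t - 1)\<^sup>2 \<le> 9 * (norm z)\<^sup>2" by (simp add: power_mult_distrib)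
    then have "K * (t - 1)\<^sup>2 \<le> K * (9 * (norm z)\<^sup>2)" using K by (rule mult_left_mono)
    ultimately show ?thesis
      using powr_quadratic_remainder[OF a t4] by (simp add: t1 K_def)
  qed
  show ?thesis
  \<comment> \<open>The two remainders contribute 9 K each, and the surviving term 2 a |z|^2
    contributes -2 a, since a \<le> 0.\<close>
  proof (rule that[of "18 * K - 2 * a"])
    show "0 \<le> 18 * K - 2 * a" using K a by simp
    fix e z :: 'a assume e: "norm e = 1" and z: "norm z \<le> 1/2"
    have 1: "\<bar>norm (z - e) powr \<sigma> - 1 - a * ((norm z)\<^sup>2 - 2 * (z \<bullet> e))\<bar> \<le> K * (9 * (norm z)\<^sup>2)"
      using *[OF e z] .
    have 2: "\<bar>norm (- z - e) powr \<sigma> - 1 - a * ((norm z)\<^sup>2 + 2 * (z \<bullet> e))\<bar> \<le> K * (9 * (norm z)\<^sup>2)"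
      using *[OF e, of "- z"] z by simp
    have 3: "a * (norm z)\<^sup>2 \<le> 0" using a by (simp add: mult_nonpos_nonneg)
    show "\<bar>norm (z - e) powr \<sigma> + norm (- z - e) powr \<sigma> - 2\<bar> \<le> (18 * K - 2 * a) * (norm z)\<^sup>2"
    proof -
      have "\<bar>p + q - 2\<bar> \<le> (18 * K - 2 * a) * w"
        if p: "\<bar>p - 1 - a * (w - 2 * y)\<bar> \<le> K * (9 * w)" and q: "\<bar>q - 1 - a * (w + 2 * y)\<bar> \<le> K * (9 * w)"
          and aw: "a * w \<le> 0" for p q w y :: real
      proof -
        have "p + q - 2 = (p - 1 - a * (w - 2 * y)) + (q - 1 - a * (w + 2 * y)) + 2 * (a * w)"
          by algebra
        also have "\<bar>\<dots>\<bar> \<le> \<bar>p - 1 - a * (w - 2 * y)\<bar> + \<bar>q - 1 - a * (w + 2 * y)\<bar> + \<bar>2 * (a * w)\<bar>"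
          by (intro order_trans[OF abs_triangle_ineq] add_right_mono abs_triangle_ineq)
        also have "\<dots> \<le> K * (9 * w) + K * (9 * w) + - (2 * (a * w))"
          using p q aw by (intro add_mono) auto
        also have "\<dots> = (18 * K - 2 * a) * w"
          by algebra
        finally show ?thesis .
      qed
      from this[OF 1 2 3] show ?thesis .
    qed
  qed
qed

section \<open>Existence of the principal value defining the coefficient\<close>

lemma integral_lborel_reflect:
  fixes f :: "'a::euclidean_space \<Rightarrow> real"
  assumes [measurable]: "f \<in> borel_measurable borel"
  shows "integrable lborel (\<lambda>z. f (- z)) \<longleftrightarrow> integrable lborel f"
    and "(\<integral>z. f (- z) \<partial>lborel) = (\<integral>z. f z \<partial>lborel)"
  using integral_lborel_similarity[of id 1 f 0]
  by (simp_all add: orthogonal_transformation_id[unfolded id_def] id_def)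

text \<open>Over the complement of a centred ball the integrand \<open>F\<close> and its even part
  \<open>S\<close> have the same integral. Near 0 the even part is O(|z|^(2 - m)), which is
  integrable because m < N + 2 in dimension N, so the truncated integrals converge to the absolutely
  convergent integral of \<open>S\<close>.\<close>

lemma pv_exists_norm_powr_difference:
  fixes e :: "'a::euclidean_space" and \<sigma> m :: real
  assumes e: "norm e = 1" and \<sigma>: "- real DIM('a) < \<sigma>" "\<sigma> \<le> 0"
    and m: "real DIM('a) < m" "m < real DIM('a) + 2" "2 \<le> m"
  shows "pv_exists (\<lambda>z. (norm (z - e) powr \<sigma> - 1) / norm z powr m) 0"
proof -
  define F where "F = (\<lambda>z. (norm (z - e) powr \<sigma> - 1) / norm z powr m)"
  define S where "S = (\<lambda>z. (F z + F (- z)) / 2)"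
  have [measurable]: "F \<in> borel_measurable borel" "S \<in> borel_measurable borel"
    unfolding F_def S_def by measurable
  have [measurable]: "ball (0::'a) r \<in> sets borel" for r by simp
  have near_e: "integrable lborel (\<lambda>z. indicator (ball e (1/2)) z * norm (z - e) powr \<sigma>)"
  proof -
    have "integrable lborel (\<lambda>z::'a. indicator (ball 0 (1/2)) z * norm z powr \<sigma>)"
      using set_integrable_norm_powr_ball[where 'a = 'a and s = \<sigma> and R = "1/2"] \<sigma> by (simp add: set_integrable_def)
    then show ?thesis
      by (subst integral_lborel_similarity(1)[of id 1 _ e])
        (simp_all add: orthogonal_transformation_id[unfolded id_def] id_def indicator_def dist_norm)
  qed
  have F: "set_integrable lborel (- ball 0 \<epsilon>) F" if \<epsilon>: "\<epsilon> > 0" for \<epsilon>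
  proof -
    have far: "integrable lborel (\<lambda>z::'a. indicator (- ball 0 \<epsilon>) z * norm z powr (- m))"
      using set_integrable_norm_powr_compl_ball[where 'a = 'a and s = "- m" and R = \<epsilon>] m \<epsilon> by (simp add: set_integrable_def)
    \<comment> \<open>Near e the singular factor is integrable and |z|^(-m) is at most
      \<epsilon>^(-m). Away from e the singular factor is at most (1/2)^\<sigma>, and |z|^(-m) is
      integrable outside the ball.\<close>
    have bd: "\<bar>indicator (- ball 0 \<epsilon>) z * F z\<bar> \<le>
        \<epsilon> powr (- m) * (indicator (ball e (1/2)) z * norm (z - e) powr \<sigma>) +
        ((1/2) powr \<sigma> + 1) * (indicator (- ball 0 \<epsilon>) z * norm z powr (- m))"
      (is "_ \<le> ?w z") for z
    proof (cases "z \<in> ball 0 \<epsilon>")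
      case False
      have zm: "norm z powr (- m) \<le> \<epsilon> powr (- m)"
        using False \<epsilon> m by (intro powr_mono2') auto
      have "\<bar>F z\<bar> = \<bar>norm (z - e) powr \<sigma> - 1\<bar> * norm z powr (- m)"
        unfolding F_def by (simp add: powr_minus divide_inverse abs_mult)
      also have "\<dots> \<le> (norm (z - e) powr \<sigma> + 1) * norm z powr (- m)"
      proof (rule mult_right_mono)
        show "\<bar>norm (z - e) powr \<sigma> - 1\<bar> \<le> norm (z - e) powr \<sigma> + 1"
          using powr_ge_zero[of "norm (z - e)" \<sigma>] by linarith
      qed simp
      also have "\<dots> \<le> ?w z"
      proof (cases "z \<in> ball e (1/2)")
        case True
        have "norm (z - e) powr \<sigma> * norm z powr (- m) \<le> \<epsilon> powr (- m) * norm (z - e) powr \<sigma>"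
          using mult_left_mono[OF zm, of "norm (z - e) powr \<sigma>"] by (simp add: mult.commute)
        then show ?thesis using True False by (simp add: algebra_simps add_increasing2)
      next
        case far: False
        then have "norm (z - e) powr \<sigma> \<le> (1/2) powr \<sigma>"
          using \<sigma> by (intro powr_mono2') (auto simp: dist_norm norm_minus_commute)
        then have "(norm (z - e) powr \<sigma> + 1) * norm z powr (- m) \<le> ((1/2) powr \<sigma> + 1) * norm z powr (- m)"
          by (intro mult_right_mono) auto
        then show ?thesis using far False by simp
      qed
      finally show ?thesis using False by simp
    qed simp
    show ?thesis
      unfolding set_integrable_def
    proof (rule Bochner_Integration.integrable_bound)
      show "integrable lborel ?w"
        by (intro Bochner_Integration.integrable_add integrable_mult_right near_e far)
      show "AE z in lborel. norm (indicator (- ball 0 \<epsilon>) z *\<^sub>R F z) \<le> norm (?w z)"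
        using bd by (intro always_eventually allI) (simp add: order_trans[OF _ abs_ge_self])
    qed measurable
  qed
  have refl: "integrable lborel (\<lambda>z. indicator (- ball 0 \<epsilon>) z * F (- z))"
    "(\<integral>z. indicator (- ball 0 \<epsilon>) z * F (- z) \<partial>lborel) = (\<integral>z. indicator (- ball 0 \<epsilon>) z * F z \<partial>lborel)"
    if "\<epsilon> > 0" for \<epsilon>
  proof -
    have "(indicator (- ball 0 \<epsilon>) (- z) :: real) = indicator (- ball 0 \<epsilon>) z" for z :: 'a
      by (simp add: indicator_def)
    then show "integrable lborel (\<lambda>z. indicator (- ball 0 \<epsilon>) z * F (- z))"
      "(\<integral>z. indicator (- ball 0 \<epsilon>) z * F (- z) \<partial>lborel) = (\<integral>z. indicator (- ball 0 \<epsilon>) z * F z \<partial>lborel)"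
      using integral_lborel_reflect[of "\<lambda>z. indicator (- ball 0 \<epsilon>) z * F z"] F[OF that]
      by (simp_all add: set_integrable_def)
  qed
  have S_eq: "indicator A z * S z = (indicator A z * F z + indicator A z * F (- z)) / 2" for A z
    by (simp add: S_def algebra_simps add_divide_distrib)
  have S_far: "integrable lborel (\<lambda>z. indicator (- ball 0 \<epsilon>) z * S z)"
    and S_val: "(\<integral>z. indicator (- ball 0 \<epsilon>) z * S z \<partial>lborel) = set_lebesgue_integral lborel (- ball 0 \<epsilon>) F"
    if "\<epsilon> > 0" for \<epsilon>
    unfolding S_eq using F[OF that] refl[OF that] by (simp_all add: set_integrable_def set_lebesgue_integral_def)
  obtain Q where Q: "Q \<ge> 0" "\<And>e z :: 'a. norm e = 1 \<Longrightarrow> norm z \<le> 1/2 \<Longrightarrow>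
      \<bar>norm (z - e) powr \<sigma> + norm (- z - e) powr \<sigma> - 2\<bar> \<le> Q * (norm z)\<^sup>2"
    using norm_powr_second_difference[OF \<sigma>(2)] by blast
  have S_near: "integrable lborel (\<lambda>z. indicator (ball 0 (1/2)) z * S z)"
  proof (rule Bochner_Integration.integrable_bound)
    have "integrable lborel (\<lambda>z::'a. indicator (ball 0 (1/2)) z * norm z powr (2 - m))"
      using set_integrable_norm_powr_ball[where 'a = 'a and s = "2 - m" and R = "1/2"] m by (simp add: set_integrable_def)
    then show "integrable lborel (\<lambda>z::'a. Q * (indicator (ball 0 (1/2)) z * norm z powr (2 - m)))"
      by (rule integrable_mult_right)
    have "\<bar>S z\<bar> \<le> Q * norm z powr (2 - m)" if z: "norm z < 1/2" for z
    proof (cases "z = 0")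
      case False
      have "S z = (norm (z - e) powr \<sigma> + norm (- z - e) powr \<sigma> - 2) / (2 * norm z powr m)"
        using False by (simp add: S_def F_def field_simps)
      then have "\<bar>S z\<bar> = \<bar>norm (z - e) powr \<sigma> + norm (- z - e) powr \<sigma> - 2\<bar> / (2 * norm z powr m)"
        by (simp add: abs_mult)
      also have "\<dots> \<le> Q * (norm z)\<^sup>2 / (2 * norm z powr m)"
        using Q(2)[OF e, of z] z by (intro divide_right_mono) auto
      also have "\<dots> \<le> Q * (norm z)\<^sup>2 / norm z powr m"
        using Q(1) False by (simp add: field_simps)
      also have "\<dots> = Q * norm z powr (2 - m)"
        using False by (simp add: powr_diff)
      finally show ?thesis .
    qed (simp add: S_def F_def)
    then show "AE z in lborel. norm (indicator (ball 0 (1/2)) z * S z)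
        \<le> norm (Q * (indicator (ball 0 (1/2)) z * norm z powr (2 - m)))"
      using Q(1) by (intro always_eventually) (auto simp: indicator_def abs_mult)
  qed measurable
  have S_int: "integrable lborel S"
  proof -
    have "integrable lborel (\<lambda>z. indicator (ball 0 (1/2)) z * S z + indicator (- ball 0 (1/2)) z * S z)"
      using S_near S_far[of "1/2"] by simp
    then show ?thesis
      by (rule Bochner_Integration.integrable_cong[THEN iffD1, rotated -1]) (auto simp: indicator_def)
  qed
  \<comment> \<open>The radius is written as 1/t so that dominated convergence applies as t tends to
    infinity, with |S| itself as majorant. At z = 0 division by zero makes \<open>S\<close>
    vanish.\<close>
  have lim: "((\<lambda>t. \<integral>z. indicator (- ball 0 (inverse t)) z * S z \<partial>lborel) \<longlongrightarrow> (\<integral>z. S z \<partial>lborel)) at_top"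
  proof (rule integral_dominated_convergence_at_top[where w = "\<lambda>z. \<bar>S z\<bar>"])
    show "\<forall>\<^sub>F t in at_top. AE z in lborel. norm (indicator (- ball 0 (inverse t)) z * S z) \<le> \<bar>S z\<bar>"
      by (intro always_eventually allI) (auto simp: indicator_def)
    show "AE z in lborel. ((\<lambda>t. indicator (- ball 0 (inverse t)) z * S z) \<longlongrightarrow> S z) at_top"
    proof (intro always_eventually allI)
      fix z
      show "((\<lambda>t. indicator (- ball 0 (inverse t)) z * S z) \<longlongrightarrow> S z) at_top"
      proof (cases "z = 0")
        case False
        have "\<forall>\<^sub>F t in at_top. indicator (- ball 0 (inverse t)) z * S z = S z"
          using eventually_ge_at_top[of "inverse (norm z)"] eventually_gt_at_top[of 0]
        proof eventually_elim
          case (elim t)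
          then have "inverse t \<le> norm z" using False by (simp add: field_simps)
          then show ?case by simp
        qed
        then show ?thesis by (rule tendsto_eventually)
      qed (simp add: S_def F_def)
    qed
  qed (use S_int in auto)
  have "((\<lambda>\<epsilon>. \<integral>z. indicator (- ball 0 \<epsilon>) z * S z \<partial>lborel) \<longlongrightarrow> (\<integral>z. S z \<partial>lborel)) (at_right 0)"
    using lim by (simp add: filterlim_at_right_to_top)
  moreover have "\<forall>\<^sub>F \<epsilon> in at_right 0. (\<integral>z. indicator (- ball 0 \<epsilon>) z * S z \<partial>lborel)
      = set_lebesgue_integral lborel (- ball 0 \<epsilon>) F"
    using eventually_at_right_less[of "0::real"] by eventually_elim (rule S_val)
  ultimately have "((\<lambda>\<epsilon>. set_lebesgue_integral lborel (- ball 0 \<epsilon>) F) \<longlongrightarrow> (\<integral>z. S z \<partial>lborel)) (at_right 0)"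
    by (rule Lim_transform_eventually)
  then have "has_pv_integral F 0 (\<integral>z. S z \<partial>lborel)"
    using F by (simp add: has_pv_integral_def)
  then show ?thesis
    unfolding pv_exists_def F_def by blast
qed

text \<open>A relation, rather than the value \<open>frac_laplacian\<close>, carries the existence
  of the principal value along, so that linearity needs no side conditions.\<close>

abbreviation has_frac_laplacian :: "real \<Rightarrow> (real^'n \<Rightarrow> real) \<Rightarrow> real^'n \<Rightarrow> real \<Rightarrow> bool" where
  "has_frac_laplacian \<alpha> f x l \<equiv> has_pv_integral (frac_kernel \<alpha> f x) x l"

text \<open>Substitute y = x - c T z, where c = |x| and T rotates e to x/c. Then |y| = c |z - e| and
  |x - y| = c |z|, so the kernel becomes -c^(\<sigma> - m) times the integrand of
  \<open>C_coeff\<close>; the Jacobian c^N turns this power into c^(\<sigma> - 2\<alpha>).\<close>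

lemma has_frac_laplacian_norm_powr:
  fixes x :: "real^'n" and i :: 'n
  assumes N: "CARD('n) \<ge> 2" and \<alpha>: "0 < \<alpha>" "\<alpha> < 1"
    and \<sigma>: "- real CARD('n) < \<sigma>" "\<sigma> \<le> 0" and x: "x \<noteq> 0"
  shows "has_frac_laplacian \<alpha> (\<lambda>y. norm y powr \<sigma>) x (- C_coeff i \<alpha> \<sigma> * norm x powr (\<sigma> - 2 * \<alpha>))"
proof -
  define m where "m = real CARD('n) + 2 * \<alpha>"
  define e where "e = (axis i 1 :: real^'n)"
  define F where "F = (\<lambda>z::real^'n. (norm (z - e) powr \<sigma> - 1) / norm z powr m)"
  define c where "c = norm x"
  have c: "c > 0" using x by (simp add: c_def)
  have e: "norm e = 1" by (simp add: e_def)
  have F: "has_pv_integral F 0 (C_coeff i \<alpha> \<sigma>)"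
    using has_pv_integral_pv_integral[OF pv_exists_norm_powr_difference[OF e, of \<sigma> m]] N \<alpha> \<sigma>
    by (simp add: F_def m_def e_def C_coeff_def)
  obtain T where T: "orthogonal_transformation T" and Te: "T e = x /\<^sub>R c"
    using orthogonal_transformation_exists_1[of e "x /\<^sub>R c"] e c by (auto simp: c_def)
  have lin: "linear T" and nT: "norm (T v) = norm v" for v
    using T by (auto simp: orthogonal_transformation_linear orthogonal_transformation_norm)
  have ker: "frac_kernel \<alpha> (\<lambda>y. norm y powr \<sigma>) x (x - c *\<^sub>R T z) = (- (c powr (\<sigma> - m))) * F z" for z
  proof -
    have "x - c *\<^sub>R T z = c *\<^sub>R T (e - z)"
      using lin Te c by (simp add: linear_diff algebra_simps)
    then have "norm (x - c *\<^sub>R T z) = c * norm (z - e)"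
      using c by (simp add: nT norm_minus_commute)
    then show ?thesis
      using c by (simp add: frac_kernel_def F_def nT m_def c_def[symmetric] powr_mult
          powr_diff field_simps) (simp add: minus_divide_left)
  qed
  have meas: "frac_kernel \<alpha> (\<lambda>y. norm y powr \<sigma>) x \<in> borel_measurable borel"
    unfolding frac_kernel_def by measurable
  have "has_pv_integral (\<lambda>z. frac_kernel \<alpha> (\<lambda>y. norm y powr \<sigma>) x (x - c *\<^sub>R T z)) 0
      (- (c powr (\<sigma> - m)) * C_coeff i \<alpha> \<sigma>)"
    unfolding ker using F by (rule has_pv_integral_cmult)
  then have "has_frac_laplacian \<alpha> (\<lambda>y. norm y powr \<sigma>) x
      (c ^ DIM(real^'n) * (- (c powr (\<sigma> - m)) * C_coeff i \<alpha> \<sigma>))"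
    by (rule has_pv_integral_similarity[OF T c meas])
  moreover have "c ^ CARD('n) * c powr (\<sigma> - m) = c powr (\<sigma> - 2 * \<alpha>)"
  proof -
    have "c ^ CARD('n) * c powr (\<sigma> - m) = c powr (real CARD('n) + (\<sigma> - m))"
      using c by (simp only: powr_add powr_realpow)
    then show ?thesis by (simp add: m_def)
  qed
  ultimately show ?thesis
    by (simp add: c_def mult_ac)
qed

section \<open>Comparison\<close>

lemma has_frac_laplacian_add:
  assumes "has_frac_laplacian \<alpha> f x k" "has_frac_laplacian \<alpha> g x l"
  shows "has_frac_laplacian \<alpha> (\<lambda>y. f y + g y) x (k + l)"
proof -
  have "frac_kernel \<alpha> (\<lambda>y. f y + g y) x = (\<lambda>y. frac_kernel \<alpha> f x y + frac_kernel \<alpha> g x y)"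
    by (auto simp: frac_kernel_def add_divide_distrib[symmetric])
  then show ?thesis
    using has_pv_integral_add[OF assms] by simp
qed

lemma has_frac_laplacian_cmult:
  assumes "has_frac_laplacian \<alpha> f x l"
  shows "has_frac_laplacian \<alpha> (\<lambda>y. k * f y) x (k * l)"
proof -
  have "frac_kernel \<alpha> (\<lambda>y. k * f y) x = (\<lambda>y. k * frac_kernel \<alpha> f x y)"
    by (auto simp: frac_kernel_def right_diff_distrib)
  then show ?thesis
    using has_pv_integral_cmult[OF assms] by simp
qed

lemma has_frac_laplacian_const: "has_frac_laplacian \<alpha> (\<lambda>y. k) x 0"
proof -
  have "frac_kernel \<alpha> (\<lambda>y. k) x = (\<lambda>y. 0)"
    by (auto simp: frac_kernel_def)
  then show ?thesis
    by (simp add: has_pv_integral_zero)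
qed

text \<open>A negative value would produce a negative minimum over all points other than the origin.
  There the kernel is nonpositive almost everywhere, hence so is the fractional Laplacian.
  Positivity is demanded only where \<open>G\<close> is negative, which is what makes the principle
  usable for nonlinear equations and for barriers.\<close>

lemma frac_laplacian_nonneg_principle:
  fixes G :: "real^'n \<Rightarrow> real"
  assumes cont: "continuous_on (- {0}) G" and S: "bounded S"
    and near: "\<forall>\<^sub>F x in at 0. G x \<ge> 0"
    and off: "\<And>x. x \<notin> S \<Longrightarrow> x \<noteq> 0 \<Longrightarrow> G x \<ge> 0"
    and super: "\<And>x. x \<in> S \<Longrightarrow> x \<noteq> 0 \<Longrightarrow> G x < 0 \<Longrightarrow> \<exists>l>0. has_frac_laplacian \<alpha> G x l"
    and x: "x \<noteq> 0"
  shows "G x \<ge> 0"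
proof (rule ccontr)
  assume neg: "\<not> 0 \<le> G x"
  obtain r where r: "r > 0" "\<And>y. y \<noteq> 0 \<Longrightarrow> norm y < r \<Longrightarrow> G y \<ge> 0"
    using near by (auto simp: eventually_at dist_norm)
  \<comment> \<open>A compact set avoiding the origin that contains every point other than the
    origin where \<open>G\<close> is negative, so a minimum over it is global off the
    origin.\<close>
  define K where "K = closure S - ball 0 r"
  have in_K: "y \<in> K" if "y \<noteq> 0" "G y < 0" for y
  proof -
    have "y \<in> S" using off[of y] that by (cases "y \<in> S") auto
    moreover have "\<not> norm y < r" using r(2)[of y] that by auto
    ultimately show ?thesis
      using closure_subset[of S] by (auto simp: K_def)
  qed
  have "compact K"
    using S by (auto simp: K_def compact_eq_bounded_closed intro: bounded_subset)
  moreover have "x \<in> K" using in_K neg x by auto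
  moreover have "continuous_on K G"
    using r(1) by (intro continuous_on_subset[OF cont]) (auto simp: K_def)
  ultimately obtain y where y: "y \<in> K" and min: "\<And>z. z \<in> K \<Longrightarrow> G y \<le> G z"
    using continuous_attains_inf[of K G] by blast
  have y0: "y \<noteq> 0" using y r(1) by (auto simp: K_def)
  have Gy: "G y < 0" using min[OF \<open>x \<in> K\<close>] neg by simp
  have "y \<in> S" using off[of y] y0 Gy by (cases "y \<in> S") auto
  then obtain l where l: "l > 0" "has_frac_laplacian \<alpha> G y l"
    using super y0 Gy by blast
  have "G y \<le> G z" if "z \<noteq> 0" for z
    using min[of z] in_K[OF that] Gy by (cases "G z < 0") auto
  then have "frac_kernel \<alpha> G y z \<le> 0" if "z \<noteq> 0" for z
    using that by (auto simp: frac_kernel_def intro!: divide_nonpos_nonneg)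
  then have "AE z in lborel. frac_kernel \<alpha> G y z \<le> 0"
    using AE_lborel_singleton[of "0 :: real^'n"] by (auto elim!: eventually_mono)
  then show False
    using has_pv_integral_nonpos[OF l(2)] l(1) by simp
qed

lemma norm_powr_filterlim_at_top:
  fixes \<sigma> :: real
  assumes "\<sigma> < 0"
  shows "filterlim (\<lambda>x::'a::euclidean_space. norm x powr \<sigma>) at_top (at 0)"
proof -
  have "filterlim (\<lambda>x::'a. norm x) (at_right 0) (at 0)"
    by (auto simp: filterlim_at eventually_at_filter intro!: tendsto_eq_intros)
  then have "filterlim (\<lambda>x::'a. ln (norm x)) at_bot (at 0)"
    by (rule filterlim_compose[OF ln_at_0])
  then have "filterlim (\<lambda>x::'a. \<sigma> * ln (norm x)) at_top (at 0)"
    using assms by (simp add: filterlim_tendsto_neg_mult_at_top_iff[OF tendsto_const])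
  then have "filterlim (\<lambda>x::'a. exp (\<sigma> * ln (norm x))) at_top (at 0)"
    by (rule filterlim_compose[OF exp_at_top])
  moreover have "\<forall>\<^sub>F x::'a in at 0. exp (\<sigma> * ln (norm x)) = norm x powr \<sigma>"
    by (auto simp: powr_def eventually_at_filter)
  ultimately show ?thesis
    by (simp cong: filterlim_cong)
qed

text \<open>
  The lower barrier \<open>\<delta>|x|\<^sup>\<tau> - \<epsilon>|x|\<^sup>\<sigma> - M\<close> with \<open>\<sigma> < \<tau>\<close> tends to \<open>-\<infinity>\<close> at the
  origin, and where it is positive its \<open>\<epsilon>\<close>-term is dominated by the \<open>\<delta>\<close>-term, so that no information on
  the sign of the two coefficients is needed. Letting \<open>\<epsilon>\<close> tend to \<open>0\<close> gives \<open>d \<ge> \<delta>|x|\<^sup>\<tau> - M\<close>,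
  which is impossible for \<open>d = o(|x|\<^sup>\<tau>)\<close>.
\<close>

lemma supersolution_not_negligible:
  fixes d :: "real^'n \<Rightarrow> real"
  assumes N: "CARD('n) \<ge> 2" and \<alpha>: "0 < \<alpha>" "\<alpha> < 1"
    and \<tau>: "- real CARD('n) < \<tau>" "\<tau> < 0"
    and cont: "continuous_on (- {0}) d"
    and small: "\<And>\<eta>. \<eta> > 0 \<Longrightarrow> \<forall>\<^sub>F x in at 0. \<bar>d x\<bar> \<le> \<eta> * norm x powr \<tau>"
    and below: "\<And>r. r > 0 \<Longrightarrow> \<exists>B. \<forall>x. norm x \<ge> r \<longrightarrow> - B \<le> d x"
    and k: "k > 0"
    and super: "\<forall>\<^sub>F x in at 0. \<exists>l \<ge> k * norm x powr (\<tau> - 2 * \<alpha>). has_frac_laplacian \<alpha> d x l"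
  shows False
proof -
  \<comment> \<open>The midpoint of -N and \<tau>: more singular than \<tau>, yet still an exponent
    whose fractional Laplacian is known.\<close>
  define \<sigma> where "\<sigma> = (\<tau> - real CARD('n)) / 2"
  have \<sigma>: "- real CARD('n) < \<sigma>" "\<sigma> < \<tau>" using \<tau> by (auto simp: \<sigma>_def)
  obtain a where a: "\<And>x::real^'n. x \<noteq> 0 \<Longrightarrow>
      has_frac_laplacian \<alpha> (\<lambda>y. norm y powr \<sigma>) x (a * norm x powr (\<sigma> - 2 * \<alpha>))"
    by (rule that[OF has_frac_laplacian_norm_powr[OF N \<alpha>]]) (use \<sigma> \<tau> in auto)
  obtain b where b: "\<And>x::real^'n. x \<noteq> 0 \<Longrightarrow>
      has_frac_laplacian \<alpha> (\<lambda>y. norm y powr \<tau>) x (b * norm x powr (\<tau> - 2 * \<alpha>))"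
    by (rule that[OF has_frac_laplacian_norm_powr[OF N \<alpha>]]) (use \<tau> in auto)
  \<comment> \<open>Chosen so that \<delta> (2|a| + |b|) < k. The 2 anticipates the bound
    2\<delta>|y|^\<tau> on the \<epsilon>-term; the 1 makes the inequality strict and the
    denominator positive.\<close>
  define \<delta> where "\<delta> = k / (2 * \<bar>a\<bar> + \<bar>b\<bar> + 1)"
  have \<delta>: "\<delta> > 0" using k by (simp add: \<delta>_def add_nonneg_pos)
  have "\<delta> * (2 * \<bar>a\<bar> + \<bar>b\<bar> + 1) = k"
    by (simp add: \<delta>_def add_nonneg_pos less_imp_neq[symmetric])
  then have \<delta>k: "\<delta> * (2 * \<bar>a\<bar> + \<bar>b\<bar>) < k"
    using \<delta> by (simp add: algebra_simps)
  have "\<forall>\<^sub>F x in at 0. \<bar>d x\<bar> \<le> \<delta> * norm x powr \<tau> \<and>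
      (\<exists>l \<ge> k * norm x powr (\<tau> - 2 * \<alpha>). has_frac_laplacian \<alpha> d x l)"
    using small[OF \<delta>] super by (rule eventually_conj)
  then obtain r where r: "r > 0" and
    r_small: "\<And>x. x \<noteq> 0 \<Longrightarrow> norm x < r \<Longrightarrow> \<bar>d x\<bar> \<le> \<delta> * norm x powr \<tau>" and
    r_super: "\<And>x. x \<noteq> 0 \<Longrightarrow> norm x < r \<Longrightarrow>
      \<exists>l \<ge> k * norm x powr (\<tau> - 2 * \<alpha>). has_frac_laplacian \<alpha> d x l"
    by (auto simp: eventually_at dist_norm)
  obtain B where B: "\<And>x. norm x \<ge> r \<Longrightarrow> - B \<le> d x" using below[OF r] by blast
  \<comment> \<open>Outside the ball this offsets both the lower bound -B of \<open>d\<close> and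
    the \<delta>-term, whatever \<epsilon> is.\<close>
  define M where "M = \<bar>B\<bar> + \<delta> * r powr \<tau>"
  have M: "M \<ge> 0" using \<delta> by (simp add: M_def)
  have barrier: "0 \<le> d x + (\<epsilon> * norm x powr \<sigma> + (- \<delta> * norm x powr \<tau> + M))"
    if \<epsilon>: "\<epsilon> > 0" and x: "x \<noteq> 0" for \<epsilon> x
  proof (rule frac_laplacian_nonneg_principle[where S = "ball 0 r" and \<alpha> = \<alpha> and x = x])
    show "continuous_on (- {0}) (\<lambda>x. d x + (\<epsilon> * norm x powr \<sigma> + (- \<delta> * norm x powr \<tau> + M)))"
      by (intro continuous_intros cont) auto
    have "\<forall>\<^sub>F x::real^'n in at 0. 2 * \<delta> / \<epsilon> \<le> norm x powr (\<sigma> - \<tau>)"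
      using norm_powr_filterlim_at_top[of "\<sigma> - \<tau>"] \<sigma> unfolding filterlim_at_top by auto
    then show "\<forall>\<^sub>F x in at 0. 0 \<le> d x + (\<epsilon> * norm x powr \<sigma> + (- \<delta> * norm x powr \<tau> + M))"
      using small[OF \<delta>]
    proof eventually_elim
      case (elim y)
      have "2 * \<delta> \<le> \<epsilon> * norm y powr (\<sigma> - \<tau>)"
        using elim(1) \<epsilon> by (simp add: field_simps)
      then have "2 * \<delta> * norm y powr \<tau> \<le> \<epsilon> * norm y powr (\<sigma> - \<tau>) * norm y powr \<tau>"
        by (rule mult_right_mono) simp
      also have "\<dots> = \<epsilon> * norm y powr \<sigma>"
        by (simp add: powr_diff)
      finally show ?case using elim(2) M by (simp add: abs_le_iff)
    qed
  next
    fix y :: "real^'n" assume y: "y \<notin> ball 0 r" "y \<noteq> 0"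
    have "norm y powr \<tau> \<le> r powr \<tau>"
      using y r \<tau> by (intro powr_mono2') auto
    then have "\<delta> * norm y powr \<tau> \<le> \<delta> * r powr \<tau>" using \<delta> by simp
    moreover have "0 \<le> \<epsilon> * norm y powr \<sigma>" using \<epsilon> by simp
    moreover have "- B \<le> d y" using B y by simp
    ultimately show "0 \<le> d y + (\<epsilon> * norm y powr \<sigma> + (- \<delta> * norm y powr \<tau> + M))"
      unfolding M_def by linarith
  next
    fix y :: "real^'n"
    assume y: "y \<in> ball 0 r" "y \<noteq> 0"
      and neg: "d y + (\<epsilon> * norm y powr \<sigma> + (- \<delta> * norm y powr \<tau> + M)) < 0"
    obtain l where l: "l \<ge> k * norm y powr (\<tau> - 2 * \<alpha>)" "has_frac_laplacian \<alpha> d y l"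
      using r_super[of y] y by auto
    define P where "P = norm y powr (\<tau> - 2 * \<alpha>)"
    define E where "E = \<epsilon> * norm y powr (\<sigma> - 2 * \<alpha>)"
    have P: "P > 0" using y by (simp add: P_def)
    have E0: "E \<ge> 0" using \<epsilon> by (simp add: E_def)
    \<comment> \<open>Negativity at y together with |d| \<le> \<delta>|y|^\<tau> bounds the
      \<epsilon>-term. Multiplied by |y|^(-2\<alpha>), this controls its fractional Laplacian
      regardless of the sign of a.\<close>
    have "\<epsilon> * norm y powr \<sigma> \<le> 2 * \<delta> * norm y powr \<tau>"
      using neg r_small[of y] y M by (simp add: abs_le_iff)
    then have "\<epsilon> * norm y powr \<sigma> * norm y powr (- 2 * \<alpha>) \<le> 2 * \<delta> * norm y powr \<tau> * norm y powr (- 2 * \<alpha>)"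
      by (rule mult_right_mono) simp
    then have E: "E \<le> 2 * \<delta> * P"
      by (simp add: E_def P_def powr_diff powr_minus divide_inverse mult.assoc)
    have "\<bar>a * E\<bar> \<le> \<bar>a\<bar> * (2 * \<delta> * P)"
      using E E0 by (simp add: abs_mult mult_left_mono)
    moreover have "\<delta> * b * P \<le> \<delta> * \<bar>b\<bar> * P"
      using \<delta> P by (intro mult_right_mono mult_left_mono) auto
    moreover have "\<bar>a\<bar> * (2 * \<delta> * P) + \<delta> * \<bar>b\<bar> * P < k * P"
      using mult_strict_right_mono[OF \<delta>k P] by (simp add: algebra_simps)
    ultimately have "0 < l + (a * E + (- (\<delta> * b * P) + 0))"
      using l(1) unfolding P_def[symmetric] by linarith
    moreover have "has_frac_laplacian \<alpha> (\<lambda>x. d x + (\<epsilon> * norm x powr \<sigma> + (- \<delta> * norm x powr \<tau> + M))) y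
        (l + (\<epsilon> * (a * norm y powr (\<sigma> - 2 * \<alpha>)) + (- \<delta> * (b * norm y powr (\<tau> - 2 * \<alpha>)) + 0)))"
      using y by (intro has_frac_laplacian_add has_frac_laplacian_cmult has_frac_laplacian_const l(2) a b) auto
    ultimately show "\<exists>l>0. has_frac_laplacian \<alpha>
        (\<lambda>x. d x + (\<epsilon> * norm x powr \<sigma> + (- \<delta> * norm x powr \<tau> + M))) y l"
      by (intro exI conjI) (auto simp: E_def P_def mult_ac)
  qed (use x in auto)
  have lower: "\<delta> * norm x powr \<tau> - M \<le> d x" if x: "x \<noteq> 0" for x
  proof (rule field_le_epsilon)
    fix e :: real assume "e > 0"
    \<comment> \<open>With this choice of \<epsilon> the \<epsilon>-term equals e at the fixed point
      x.\<close>
    then show "\<delta> * norm x powr \<tau> - M \<le> d x + e"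
      using barrier[of "e / norm x powr \<sigma>" x] x by simp
  qed
  \<comment> \<open>The lower bound and d \<le> (\<delta>/2)|x|^\<tau> would force
    \<delta>|x|^\<tau> \<le> 2M, which fails near the origin.\<close>
  have "\<forall>\<^sub>F x::real^'n in at 0. 2 * M / \<delta> + 1 \<le> norm x powr \<tau>"
    using norm_powr_filterlim_at_top[of \<tau>] \<tau> unfolding filterlim_at_top by auto
  moreover have "\<forall>\<^sub>F x in at 0. \<bar>d x\<bar> \<le> \<delta> / 2 * norm x powr \<tau>"
    using \<delta> by (intro small) simp
  moreover have "\<forall>\<^sub>F x::real^'n in at 0. x \<noteq> 0"
    by (simp add: eventually_at_filter)
  ultimately have "\<forall>\<^sub>F x::real^'n in at 0. False"
  proof eventually_elim
    case (elim x)
    have "2 * M + \<delta> \<le> \<delta> * norm x powr \<tau>"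
      using elim(1) \<delta> by (simp add: field_simps)
    then show ?case
      using lower[OF elim(3)] elim(2) \<delta> by (simp add: abs_le_iff)
  qed
  then show False
    by simp
qed

text \<open>The factor z < 1 gives room at the origin, where only the ratio of \<open>f\<close> and
  \<open>g\<close> is controlled. It costs nothing in the equation: where g < z f, the inequality
  g^p < z^p f^p \<le> z f^p makes the fractional Laplacian of g - z f + M positive. Finally z tends
  to 1.\<close>

lemma solution_comparison:
  fixes f g :: "real^'n \<Rightarrow> real"
  assumes p: "p > 1" and cont: "continuous_on (- {0}) f" "continuous_on (- {0}) g"
    and S: "bounded S" and M: "M \<ge> 0"
    and f: "\<And>x. x \<in> S \<Longrightarrow> x \<noteq> 0 \<Longrightarrow> has_frac_laplacian \<alpha> f x (- (f x powr p))"
    and g: "\<And>x. x \<in> S \<Longrightarrow> x \<noteq> 0 \<Longrightarrow> has_frac_laplacian \<alpha> g x (- (g x powr p))"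
    and nonneg: "\<And>x. x \<noteq> 0 \<Longrightarrow> f x \<ge> 0" "\<And>x. x \<noteq> 0 \<Longrightarrow> g x \<ge> 0"
    and near: "\<And>z. 0 < z \<Longrightarrow> z < 1 \<Longrightarrow> \<forall>\<^sub>F x in at 0. z * f x \<le> g x"
    and off: "\<And>x. x \<notin> S \<Longrightarrow> x \<noteq> 0 \<Longrightarrow> f x \<le> g x + M"
    and x: "x \<noteq> 0"
  shows "f x \<le> g x + M"
proof (rule field_le_mult_one_interval)
  fix z :: real assume z: "0 < z" "z < 1"
  have "0 \<le> g x + (- z * f x + M)"
  proof (rule frac_laplacian_nonneg_principle[where S = S and \<alpha> = \<alpha> and x = x])
    show "continuous_on (- {0}) (\<lambda>x. g x + (- z * f x + M))"
      by (intro continuous_intros cont)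
    show "\<forall>\<^sub>F x in at 0. 0 \<le> g x + (- z * f x + M)"
      using near[OF z] by eventually_elim (use M in simp)
  next
    fix y assume y: "y \<notin> S" "y \<noteq> 0"
    have "z * f y \<le> f y" using z nonneg(1)[OF y(2)] by (simp add: mult_left_le_one_le)
    then show "0 \<le> g y + (- z * f y + M)" using off[OF y] by simp
  next
    fix y assume y: "y \<in> S" "y \<noteq> 0" and neg: "g y + (- z * f y + M) < 0"
    have gf: "g y < z * f y" using neg M by simp
    then have "f y > 0" using nonneg(2)[OF y(2)] z by (smt (verit) zero_less_mult_pos)
    have "g y powr p < (z * f y) powr p"
      using gf nonneg(2)[OF y(2)] p by (intro powr_less_mono2) auto
    also have "\<dots> = z powr p * f y powr p"
      using z \<open>f y > 0\<close> by (simp add: powr_mult)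
    also have "\<dots> \<le> z powr 1 * f y powr p"
      using z p by (intro mult_right_mono powr_mono') auto
    finally have "0 < - (g y powr p) + (- z * - (f y powr p) + 0)"
      using z by simp
    moreover have "has_frac_laplacian \<alpha> (\<lambda>x. g x + (- z * f x + M)) y
        (- (g y powr p) + (- z * - (f y powr p) + 0))"
      using y by (intro has_frac_laplacian_add has_frac_laplacian_cmult has_frac_laplacian_const f g)
    ultimately show "\<exists>l>0. has_frac_laplacian \<alpha> (\<lambda>x. g x + (- z * f x + M)) y l"
      by blast
  qed (use S x in auto)
  then show "z * f x \<le> g x + M" by simp
qed

section \<open>Identification of the limit and two-sided bound for the singular solution\<close>

theorem mainTheorem2:
  fixes \<Omega> :: "(real^'n) set" and u :: "real^'n \<Rightarrow> real"
    and \<alpha> p \<tau>\<^sub>p C\<^sub>1 :: real and i :: 'n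
  assumes "CARD('n) \<ge> 2"
    and "0 < \<alpha>" and "\<alpha> < 1"
    and "smooth_bounded_domain \<Omega>" and "0 \<in> \<Omega>"
    and "1 + 2 * \<alpha> / real CARD('n) < p"
    and "p < real CARD('n) / (real CARD('n) - 2 * \<alpha>)"
    and "\<tau>\<^sub>p = - (2 * \<alpha> / (p - 1))"
    and "C\<^sub>1 = C_coeff i \<alpha> \<tau>\<^sub>p powr (1 / (p - 1))"
    and "singular_solution \<alpha> p \<Omega> u"
    and "\<forall>x \<in> \<Omega> - {0}. u x > 0"
    and "\<exists>C>0. ((\<lambda>x. u x * norm x powr (2 * \<alpha> / (p - 1))) \<longlongrightarrow> C) (at 0)"
  shows "\<exists>C\<^sub>2>0. \<forall>x \<in> \<Omega> - {0}. \<bar>u x - C\<^sub>1 * norm x powr (- (2 * \<alpha> / (p - 1)))\<bar> < C\<^sub>2"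
proof -
  note N = assms(1) and \<alpha> = assms(2,3) and sol = assms(10) and pos = assms(11)
  define \<tau> where "\<tau> = \<tau>\<^sub>p"
  have "0 < 2 * \<alpha> / real CARD('n)" using N \<alpha> by simp
  then have p: "p > 1" using assms(6) by linarith
  have \<tau>_eq: "2 * \<alpha> / (p - 1) = - \<tau>" using assms(8) by (simp add: \<tau>_def)
  have "2 * \<alpha> / real CARD('n) < p - 1" using assms(6) by simp
  then have "2 * \<alpha> / (p - 1) < real CARD('n)"
    using N p by (simp add: field_simps)
  moreover have "0 < 2 * \<alpha> / (p - 1)" using \<alpha> p by simp
  ultimately have \<tau>: "- real CARD('n) < \<tau>" "\<tau> < 0" unfolding \<tau>_eq by auto
  \<comment> \<open>The scaling balance: the fractional Laplacian of |x|^\<tau> and its p-th power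
    have the same homogeneity.\<close>
  have "2 * \<alpha> = - \<tau> * (p - 1)" using \<tau>_eq p by (simp add: field_simps)
  then have \<tau>p: "\<tau> * p = \<tau> - 2 * \<alpha>" by (simp add: algebra_simps)
  obtain C where C: "C > 0" and lim: "((\<lambda>x. u x * norm x powr (- \<tau>)) \<longlongrightarrow> C) (at 0)"
    using assms(12) unfolding \<tau>_eq by blast
  have \<Omega>: "open \<Omega>" "bounded \<Omega>" using assms(4) by (auto simp: smooth_bounded_domain_def)
  obtain R where R: "R > 0" "ball 0 R \<subseteq> \<Omega>" using \<Omega>(1) assms(5) openE by blast
  have cont: "continuous_on (- {0}) u" and zero: "\<And>x. x \<notin> \<Omega> \<Longrightarrow> u x = 0"
    using sol by (auto simp: singular_solution_def)
  have u0: "u x \<ge> 0" if "x \<noteq> 0" for x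
    using pos zero[of x] that by (cases "x \<in> \<Omega>") (auto simp: less_imp_le)
  have Lu: "has_frac_laplacian \<alpha> u x (- (u x powr p))" if "x \<in> \<Omega>" "x \<noteq> 0" for x
  proof -
    have ux: "u x > 0" using pos that by auto
    have ex: "pv_exists (frac_kernel \<alpha> u x) x"
      and eq: "frac_laplacian \<alpha> u x + \<bar>u x\<bar> powr (p - 1) * u x = 0"
      using sol that by (auto simp: singular_solution_def)
    have "\<bar>u x\<bar> powr (p - 1) * u x = u x powr p"
      using ux by (simp add: powr_diff)
    then have "pv_integral (frac_kernel \<alpha> u x) x = - (u x powr p)"
      using eq by (simp add: frac_laplacian_def)
    then show ?thesis using has_pv_integral_pv_integral[OF ex] by simp
  qed
  define a where "a = C_coeff i \<alpha> \<tau>"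
  have Lw: "has_frac_laplacian \<alpha> (\<lambda>y. norm y powr \<tau>) x (- a * norm x powr (\<tau> - 2 * \<alpha>))"
    if "x \<noteq> 0" for x :: "real^'n"
    using has_frac_laplacian_norm_powr[OF N \<alpha> \<tau>(1) _ that, of i] \<tau> by (simp add: a_def)
  have not0: "\<forall>\<^sub>F x::real^'n in at 0. x \<noteq> 0"
    by (simp add: eventually_at_filter)
  have in_\<Omega>: "\<forall>\<^sub>F x in at 0. x \<in> \<Omega>"
    using eventually_at_topological \<Omega>(1) assms(5) by blast
  define \<kappa> where "\<kappa> = C * a - C powr p"
  \<comment> \<open>The sign s treats the difference and its negative together; both cases give
    \<kappa> = 0.\<close>
  have \<kappa>: "\<not> s * \<kappa> > 0" if s: "s = 1 \<or> s = - 1" for s :: real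
  proof
    assume pos\<kappa>: "s * \<kappa> > 0"
    let ?d = "\<lambda>x. s * (u x + (- C) * norm x powr \<tau>)"
    have abs_d: "\<bar>?d x\<bar> = \<bar>u x - C * norm x powr \<tau>\<bar>" for x
      using s by auto
    show False
    \<comment> \<open>Half of s\<kappa> serves as k because the fractional Laplacian of the
      difference, divided by |x|^(\<tau> - 2\<alpha>), only tends to s\<kappa>.\<close>
    proof (rule supersolution_not_negligible[OF N \<alpha> \<tau>, where d = ?d and k = "s * \<kappa> / 2"])
      show "continuous_on (- {0}) ?d"
        by (intro continuous_intros cont) auto
      show "\<forall>\<^sub>F x in at 0. \<bar>?d x\<bar> \<le> \<eta> * norm x powr \<tau>" if "\<eta> > 0" for \<eta>
        using tendstoD[OF lim that] not0
      proof eventually_elim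
        case (elim x)
        then have "\<bar>u x * norm x powr (- \<tau>) - C\<bar> * norm x powr \<tau> \<le> \<eta> * norm x powr \<tau>"
          by (intro mult_right_mono) (auto simp: dist_norm)
        moreover have "\<bar>u x * norm x powr (- \<tau>) - C\<bar> * norm x powr \<tau> = \<bar>(u x * norm x powr (- \<tau>) - C) * norm x powr \<tau>\<bar>"
          by (simp add: abs_mult)
        moreover have "(u x * norm x powr (- \<tau>) - C) * norm x powr \<tau> = u x - C * norm x powr \<tau>"
          using elim(2) by (simp add: powr_minus left_diff_distrib)
        ultimately show ?case unfolding abs_d by simp
      qed
      show "\<exists>B. \<forall>x. norm x \<ge> r \<longrightarrow> - B \<le> ?d x" if r: "r > 0" for r
      proof -
        have "compact (closure \<Omega> - ball 0 r)"
          using \<Omega>(2) by (auto simp: compact_eq_bounded_closed intro: bounded_subset)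
        moreover have "continuous_on (closure \<Omega> - ball 0 r) u"
          using r by (intro continuous_on_subset[OF cont]) auto
        ultimately have "bounded (u ` (closure \<Omega> - ball 0 r))"
          by (intro compact_imp_bounded compact_continuous_image)
        then obtain B where B: "\<And>x. x \<in> closure \<Omega> - ball 0 r \<Longrightarrow> \<bar>u x\<bar> \<le> B"
          unfolding bounded_iff by (auto simp del: Diff_iff)
        have "- (\<bar>B\<bar> + C * r powr \<tau>) \<le> ?d x" if x: "norm x \<ge> r" for x
        proof -
          have "\<bar>u x\<bar> \<le> \<bar>B\<bar>"
          proof (cases "x \<in> \<Omega>")
            case True
            then have "x \<in> closure \<Omega> - ball 0 r" using x closure_subset[of \<Omega>] by auto
            then show ?thesis using B by fastforce
          qed (simp add: zero)
          moreover have "norm x powr \<tau> \<le> r powr \<tau>"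
            using x r \<tau> by (intro powr_mono2') auto
          then have "C * norm x powr \<tau> \<le> C * r powr \<tau>" using C by simp
          moreover have "0 \<le> C * norm x powr \<tau>" using C by simp
          ultimately have "\<bar>?d x\<bar> \<le> \<bar>B\<bar> + C * r powr \<tau>"
            unfolding abs_d by linarith
          then show ?thesis by linarith
        qed
        then show ?thesis by blast
      qed
      have lim\<kappa>: "((\<lambda>x. s * (C * a - (u x * norm x powr (- \<tau>)) powr p)) \<longlongrightarrow> s * \<kappa>) (at 0)"
        unfolding \<kappa>_def using C by (intro tendsto_intros lim) auto
      have "s * \<kappa> / 2 < s * \<kappa>" using pos\<kappa> by linarith
      with lim\<kappa> have "\<forall>\<^sub>F x in at 0. s * \<kappa> / 2 < s * (C * a - (u x * norm x powr (- \<tau>)) powr p)"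
        by (rule order_tendstoD(1))
      then show "\<forall>\<^sub>F x in at 0. \<exists>l \<ge> s * \<kappa> / 2 * norm x powr (\<tau> - 2 * \<alpha>). has_frac_laplacian \<alpha> ?d x l"
        using not0 in_\<Omega>
      proof eventually_elim
        case (elim x)
        \<comment> \<open>By \<tau> p = \<tau> - 2\<alpha>, the power |x|^(\<tau> - 2\<alpha>)
          factors out of u^p and leaves a quantity with limit C^p.\<close>
        have "(u x * norm x powr (- \<tau>)) powr p = u x powr p * norm x powr (- (\<tau> * p))"
          using u0[OF elim(2)] by (simp add: powr_mult powr_powr)
        then have "u x powr p = (u x * norm x powr (- \<tau>)) powr p * norm x powr (\<tau> - 2 * \<alpha>)"
          using elim(2) by (simp add: \<tau>p powr_add[symmetric] mult.assoc)
        then have "s * (- (u x powr p) + - C * (- a * norm x powr (\<tau> - 2 * \<alpha>))) =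
            s * (C * a - (u x * norm x powr (- \<tau>)) powr p) * norm x powr (\<tau> - 2 * \<alpha>)"
          by (simp add: algebra_simps)
        moreover have "s * \<kappa> / 2 * norm x powr (\<tau> - 2 * \<alpha>) \<le>
            s * (C * a - (u x * norm x powr (- \<tau>)) powr p) * norm x powr (\<tau> - 2 * \<alpha>)"
          using elim(1) by (intro mult_right_mono) auto
        moreover have "has_frac_laplacian \<alpha> ?d x (s * (- (u x powr p) + - C * (- a * norm x powr (\<tau> - 2 * \<alpha>))))"
          using elim by (intro has_frac_laplacian_cmult has_frac_laplacian_add Lu Lw)
        ultimately show ?case by metis
      qed
    qed (use pos\<kappa> in simp)
  qed
  have "\<kappa> = 0" using \<kappa>[of 1] \<kappa>[of "-1"] by simp
  then have Ca: "C * a = C powr p" by (simp add: \<kappa>_def)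
  \<comment> \<open>Cancelling C > 0 yields a = C^(p - 1), whose power 1/(p - 1) is C again.\<close>
  have "C * C powr (p - 1) = C powr p" using C by (simp add: powr_diff)
  then have "a = C powr (p - 1)" using Ca C by (metis mult_left_cancel less_irrefl)
  then have C1: "C\<^sub>1 = C"
    using assms(9) C p by (simp add: a_def \<tau>_def powr_powr)
  define W where "W = (\<lambda>x::real^'n. C * norm x powr \<tau>)"
  have W0: "W x \<ge> 0" for x using C by (simp add: W_def)
  have Wcont: "continuous_on (- {0}) W"
    unfolding W_def by (intro continuous_intros) auto
  have LW: "has_frac_laplacian \<alpha> W x (- (W x powr p))" if "x \<noteq> 0" for x
  proof -
    have "C * (- a * norm x powr (\<tau> - 2 * \<alpha>)) = - (C * a * norm x powr (\<tau> - 2 * \<alpha>))"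
      by simp
    also have "\<dots> = - (W x powr p)"
      using C unfolding Ca W_def by (simp add: powr_mult powr_powr \<tau>p)
    finally show ?thesis
      using has_frac_laplacian_cmult[OF Lw[OF that], of C] by (simp add: W_def)
  qed
  \<comment> \<open>As the ball of radius R lies in \<Omega>, this bounds \<open>W\<close> outside
    \<Omega>, where \<open>u\<close> vanishes.\<close>
  define M where "M = C * R powr \<tau>"
  have M: "M \<ge> 0" using C by (simp add: M_def)
  have cancel: "norm x powr (- \<tau>) * norm x powr \<tau> = 1" if "x \<noteq> 0" for x :: "real^'n"
    using that by (simp add: powr_minus)
  \<comment> \<open>No additive constant is needed here: outside \<Omega> the solution is 0 and
    \<open>W\<close> is nonnegative. Near 0, z u |x|^(-\<tau>) tends to z C < C.\<close>
  have upper: "u x \<le> W x + 0" if "x \<noteq> 0" for x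
  proof (rule solution_comparison[OF p cont Wcont \<Omega>(2), where \<alpha> = \<alpha>])
    fix z :: real assume z: "0 < z" "z < 1"
    have "((\<lambda>x. z * (u x * norm x powr (- \<tau>))) \<longlongrightarrow> z * C) (at 0)"
      by (intro tendsto_intros lim)
    then have "\<forall>\<^sub>F x in at 0. z * (u x * norm x powr (- \<tau>)) < C"
      by (rule order_tendstoD(2)) (use z C in simp)
    then show "\<forall>\<^sub>F x in at 0. z * u x \<le> W x"
      using not0
    proof eventually_elim
      case (elim x)
      have "z * (u x * norm x powr (- \<tau>)) * norm x powr \<tau> \<le> C * norm x powr \<tau>"
        using elim(1) by (intro mult_right_mono) auto
      then show ?case using cancel[OF elim(2)] by (simp add: W_def mult.assoc)
    qed
  qed (use that Lu LW u0 W0 zero in auto)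
  have lower: "W x \<le> u x + M" if "x \<noteq> 0" for x
  proof (rule solution_comparison[OF p Wcont cont \<Omega>(2) M, where \<alpha> = \<alpha>])
    fix z :: real assume z: "0 < z" "z < 1"
    have "\<forall>\<^sub>F x in at 0. z * C < u x * norm x powr (- \<tau>)"
      using lim by (rule order_tendstoD(1)) (use z C in simp)
    then show "\<forall>\<^sub>F x in at 0. z * W x \<le> u x"
      using not0
    proof eventually_elim
      case (elim x)
      have "z * C * norm x powr \<tau> \<le> u x * norm x powr (- \<tau>) * norm x powr \<tau>"
        using elim(1) by (intro mult_right_mono) auto
      then show ?case using cancel[OF elim(2)] by (simp add: W_def mult.assoc)
    qed
  next
    fix y assume y: "y \<notin> \<Omega>" "y \<noteq> 0"
    then have "R \<le> norm y" using R(2) by (auto simp: subset_iff not_less[symmetric])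
    then have "norm y powr \<tau> \<le> R powr \<tau>"
      using R(1) \<tau> by (intro powr_mono2') auto
    then show "W y \<le> u y + M" using C y by (simp add: W_def M_def zero)
  qed (use that Lu LW u0 W0 in auto)
  show ?thesis
  proof (intro exI conjI ballI)
    \<comment> \<open>The added 1 makes the bound strict.\<close>
    show "M + 1 > 0" using M by simp
    fix x assume "x \<in> \<Omega> - {0}"
    then have "u x \<le> W x" "W x \<le> u x + M" using upper[of x] lower[of x] by auto
    then show "\<bar>u x - C\<^sub>1 * norm x powr (- (2 * \<alpha> / (p - 1)))\<bar> < M + 1"
      unfolding \<tau>_eq C1 using M by (simp add: W_def abs_if)
  qed
qed

end
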